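(* Let $\mathcal{H}$ be a simple $r$-uniform and $r$-partite hypergraph, let $k$ be a field, and let $I=I(\mathcal{H})\subseteq k[V(\mathcal{H})]$ be its edge ideal. Then the Waldschmidt constant of $I$ is $\widehat{\alpha}(I)=r$.
   Context: A simple hypergraph on a finite set $X=\{x_1,\dots,x_n\}$ of vertices is a family $\mathcal{H}=(E_1,\dots,E_q)$ of nonempty subsets of $X$ (hyperedges) with $\bigcup_i E_i=X$ and no $E_i$ contained in another; write $V(\mathcal{H})=X$. $\mathcal{H}$ is $r$-uniform if every hyperedge has exactly $r$ elements. A uniform hypergraph $\mathcal{H}$ is $r$-partite if $V(\mathcal{H})=\bigcup_{i=1}^r X_i$ with $X_1,\dots,X_r$ pairwise disjoint, each $X_i$ a vertex cover of $\mathcal{H}$ (i.e. $X_i$ meets every hyperedge), and $|X_i\cap E|=1$ for every hyperedge $E$ and every $i$. Identifying vertices with variables, the edge ideal of an $r$-uniform hypergraph $\mathcal{H}$ is the squarefree monomial ideal $I(\mathcal{H})=(\prod_{x\in E}x : E\in\mathcal{H})$ in the polynomial ring $k[V(\mathcal{H})]$ over a field $k$. For an ideal $I$ in a Noetherian domain $R$, the $n$-th symbolic power is $I^{(n)}=\bigcap_{\mathfrak{p}\in \mathrm{Ass}_R(R/I)}(I^nR_{\mathfrak{p}}\cap R)$. For a nonzero homogeneous ideal $I$, $\alpha(I)=\min\{d: I_d\neq 0\}$ is the least degree of a nonzero homogeneous element of $I$, and the Waldschmidt constant is $\widehat{\alpha}(I)=\lim_{n\to\infty}\alpha(I^{(n)})/n$.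 *)

theory Defs
  imports Complex_Main "HOL-Library.Poly_Mapping" "HOL-Algebra.QuotRing" "HOL-Algebra.Ideal_Product"
begin

section \<open>Hypergraphs\<close>

text \<open>A simple hypergraph is given by its vertex set and its set of hyperedges. A set suffices:
  in a family in which no member is contained in another one, the members are distinct.\<close>

definition simple_hypergraph :: "'a set \<Rightarrow> 'a set set \<Rightarrow> bool" where
  "simple_hypergraph X H \<longleftrightarrow>
     finite X \<and> (\<forall>E\<in>H. E \<noteq> {}) \<and> \<Union>H = X \<and> (\<forall>E\<in>H. \<forall>F\<in>H. E \<subseteq> F \<longrightarrow> E = F)"

definition uniform_hypergraph :: "nat \<Rightarrow> 'a set set \<Rightarrow> bool" where
  "uniform_hypergraph r H \<longleftrightarrow> (\<forall>E\<in>H. card E = r)"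

definition vertex_cover :: "'a set \<Rightarrow> 'a set set \<Rightarrow> 'a set \<Rightarrow> bool" where
  "vertex_cover X H C \<longleftrightarrow> C \<subseteq> X \<and> (\<forall>E\<in>H. C \<inter> E \<noteq> {})"

definition partite_hypergraph :: "nat \<Rightarrow> 'a set \<Rightarrow> 'a set set \<Rightarrow> bool" where
  "partite_hypergraph r X H \<longleftrightarrow>
     (\<exists>P :: nat \<Rightarrow> 'a set.
        X = (\<Union>i\<in>{1..r}. P i) \<and>
        (\<forall>i\<in>{1..r}. \<forall>j\<in>{1..r}. i \<noteq> j \<longrightarrow> P i \<inter> P j = {}) \<and>
        (\<forall>i\<in>{1..r}. vertex_cover X H (P i)) \<and>
        (\<forall>i\<in>{1..r}. \<forall>E\<in>H. card (P i \<inter> E) = 1))"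


section \<open>Polynomial rings and edge ideals\<close>

text \<open>A monomial is a finitely supported exponent vector \<open>'a \<Rightarrow>\<^sub>0 nat\<close>, and a polynomial a finitely
  supported family of coefficients indexed by monomials; multiplication of polynomials is the
  convolution product of \<^theory>\<open>HOL-Library.Poly_Mapping\<close>. The ring \<open>k[X]\<close> consists of the
  polynomials all of whose monomials involve only variables from \<open>X\<close>.\<close>

type_synonym ('a, 'k) poly_in = "('a \<Rightarrow>\<^sub>0 nat) \<Rightarrow>\<^sub>0 'k"

definition polynomial_ring :: "'a set \<Rightarrow> ('a, 'k::field) poly_in ring" where
  "polynomial_ring X =
     \<lparr>carrier = {f. \<forall>m\<in>Poly_Mapping.keys f. Poly_Mapping.keys m \<subseteq> X}, mult = (*), one = 1, zero = 0, add = (+)\<rparr>"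

lemma polynomial_ring_cring: "cring (polynomial_ring X :: ('a, 'k::field) poly_in ring)"
proof -
  have *: "\<forall>m\<in>Poly_Mapping.keys (f + g). Poly_Mapping.keys m \<subseteq> X"
    if "\<forall>m\<in>Poly_Mapping.keys f. Poly_Mapping.keys m \<subseteq> X" "\<forall>m\<in>Poly_Mapping.keys g. Poly_Mapping.keys m \<subseteq> X"
    for f g :: "('a, 'k) poly_in"
    using that Poly_Mapping.keys_add[of f g] by blast
  have **: "\<forall>m\<in>Poly_Mapping.keys (f * g). Poly_Mapping.keys m \<subseteq> X"
    if "\<forall>m\<in>Poly_Mapping.keys f. Poly_Mapping.keys m \<subseteq> X" "\<forall>m\<in>Poly_Mapping.keys g. Poly_Mapping.keys m \<subseteq> X"
    for f g :: "('a, 'k) poly_in"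
  proof
    fix m assume "m \<in> Poly_Mapping.keys (f * g)"
    then obtain a b where "m = a + b" "a \<in> Poly_Mapping.keys f" "b \<in> Poly_Mapping.keys g"
      using keys_mult[of f g] by blast
    then show "Poly_Mapping.keys m \<subseteq> X" using that Poly_Mapping.keys_add[of a b] by blast
  qed
  have carr: "f \<in> carrier (polynomial_ring X) \<longleftrightarrow> (\<forall>m\<in>Poly_Mapping.keys f. Poly_Mapping.keys m \<subseteq> X)"
    for f :: "('a, 'k) poly_in"
    by (simp add: polynomial_ring_def)
  have ops: "\<And>f g :: ('a, 'k) poly_in. f \<oplus>\<^bsub>polynomial_ring X\<^esub> g = f + g"
    "\<And>f g :: ('a, 'k) poly_in. f \<otimes>\<^bsub>polynomial_ring X\<^esub> g = f * g"
    "\<zero>\<^bsub>polynomial_ring X\<^esub> = (0 :: ('a, 'k) poly_in)" "\<one>\<^bsub>polynomial_ring X\<^esub> = (1 :: ('a, 'k) poly_in)"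
    by (simp_all add: polynomial_ring_def)
  show ?thesis
  proof (rule cringI)
    show "abelian_group (polynomial_ring X :: ('a, 'k) poly_in ring)"
    proof (rule abelian_groupI, unfold ops carr)
      fix f g :: "('a, 'k) poly_in"
      assume f: "\<forall>m\<in>Poly_Mapping.keys f. Poly_Mapping.keys m \<subseteq> X"
      show "\<exists>h\<in>carrier (polynomial_ring X). h + f = 0"
        by (rule bexI[of _ "- f"]) (use f in \<open>simp_all add: carr\<close>)
      assume g: "\<forall>m\<in>Poly_Mapping.keys g. Poly_Mapping.keys m \<subseteq> X"
      show "\<forall>m\<in>Poly_Mapping.keys (f + g). Poly_Mapping.keys m \<subseteq> X"
        by (rule *[OF f g])
    qed (simp_all add: add.assoc add.commute)
    show "comm_monoid (polynomial_ring X :: ('a, 'k) poly_in ring)"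
    proof (rule comm_monoidI, unfold ops carr)
      fix f g :: "('a, 'k) poly_in"
      assume f: "\<forall>m\<in>Poly_Mapping.keys f. Poly_Mapping.keys m \<subseteq> X"
        and g: "\<forall>m\<in>Poly_Mapping.keys g. Poly_Mapping.keys m \<subseteq> X"
      show "\<forall>m\<in>Poly_Mapping.keys (f * g). Poly_Mapping.keys m \<subseteq> X"
        by (rule **[OF f g])
    qed (simp_all add: mult.assoc mult.commute)
  qed (simp add: ops distrib_right)
qed

definition var :: "'a \<Rightarrow> ('a, 'k::field) poly_in" where
  "var x = Poly_Mapping.single (Poly_Mapping.single x 1) 1"

definition edge_ideal :: "'a set \<Rightarrow> 'a set set \<Rightarrow> ('a, 'k::field) poly_in set" where
  "edge_ideal X H = Idl\<^bsub>polynomial_ring X\<^esub> ((\<lambda>E. \<Prod>x\<in>E. var x) ` H)"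


section \<open>Localization at a prime ideal\<close>

text \<open>Fractions with numerator in \<open>R\<close> and denominator in \<open>R - p\<close>, for a prime ideal \<open>p\<close> of a
  commutative ring \<open>R\<close>. If \<open>R\<close> is a domain, the factor \<open>u\<close> can be cancelled.\<close>

definition fraction_rel :: "('r, 'm) ring_scheme \<Rightarrow> 'r set \<Rightarrow> (('r \<times> 'r) \<times> ('r \<times> 'r)) set" where
  "fraction_rel R p =
     {((a, s), (b, t)). a \<in> carrier R \<and> s \<in> carrier R - p \<and> b \<in> carrier R \<and> t \<in> carrier R - p \<and>
        (\<exists>u\<in>carrier R - p. u \<otimes>\<^bsub>R\<^esub> (t \<otimes>\<^bsub>R\<^esub> a) = u \<otimes>\<^bsub>R\<^esub> (s \<otimes>\<^bsub>R\<^esub> b))}"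

definition fraction :: "('r, 'm) ring_scheme \<Rightarrow> 'r set \<Rightarrow> 'r \<Rightarrow> 'r \<Rightarrow> ('r \<times> 'r) set" where
  "fraction R p a s = fraction_rel R p `` {(a, s)}"

definition localization :: "('r, 'm) ring_scheme \<Rightarrow> 'r set \<Rightarrow> ('r \<times> 'r) set ring" where
  "localization R p =
     \<lparr>carrier = (carrier R \<times> (carrier R - p)) // fraction_rel R p,
      mult = (\<lambda>A B. \<Union>(a, s)\<in>A. \<Union>(b, t)\<in>B. fraction R p (a \<otimes>\<^bsub>R\<^esub> b) (s \<otimes>\<^bsub>R\<^esub> t)),
      one = fraction R p \<one>\<^bsub>R\<^esub> \<one>\<^bsub>R\<^esub>,
      zero = fraction R p \<zero>\<^bsub>R\<^esub> \<one>\<^bsub>R\<^esub>,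
      add = (\<lambda>A B. \<Union>(a, s)\<in>A. \<Union>(b, t)\<in>B.
               fraction R p ((t \<otimes>\<^bsub>R\<^esub> a) \<oplus>\<^bsub>R\<^esub> (s \<otimes>\<^bsub>R\<^esub> b)) (s \<otimes>\<^bsub>R\<^esub> t))\<rparr>"

definition to_localization :: "('r, 'm) ring_scheme \<Rightarrow> 'r set \<Rightarrow> 'r \<Rightarrow> ('r \<times> 'r) set" where
  "to_localization R p f = fraction R p f \<one>\<^bsub>R\<^esub>"

text \<open>The extended ideal \<open>J R\<^sub>p\<close>, and the contraction of an ideal of \<open>R\<^sub>p\<close> to \<open>R\<close>.\<close>

definition extended_ideal :: "('r, 'm) ring_scheme \<Rightarrow> 'r set \<Rightarrow> 'r set \<Rightarrow> ('r \<times> 'r) set set" where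
  "extended_ideal R p J = Idl\<^bsub>localization R p\<^esub> (to_localization R p ` J)"

definition contracted_ideal :: "('r, 'm) ring_scheme \<Rightarrow> 'r set \<Rightarrow> ('r \<times> 'r) set set \<Rightarrow> 'r set" where
  "contracted_ideal R p L = {f \<in> carrier R. to_localization R p f \<in> L}"


subsection \<open>The localization is a ring, and \<open>f \<in> J R\<^sub>p \<inter> R\<close> iff \<open>s f \<in> J\<close> for some \<open>s \<notin> p\<close>\<close>

lemma UN2_const:
  assumes "(a, s) \<in> A" "(b, t) \<in> B" "\<And>a s b t. (a, s) \<in> A \<Longrightarrow> (b, t) \<in> B \<Longrightarrow> F a s b t = c"
  shows "(\<Union>(a, s)\<in>A. \<Union>(b, t)\<in>B. F a s b t) = c"
proof -
  have "(\<Union>(a, s)\<in>A. \<Union>(b, t)\<in>B. F a s b t) = (\<Union>_\<in>A. \<Union>_\<in>B. c)"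
    using assms(3) by (intro SUP_cong) auto
  then show ?thesis using assms(1,2) by auto
qed

context primeideal begin

definition "dens = carrier R - I"

lemma dens_carr: "s \<in> dens \<Longrightarrow> s \<in> carrier R" by (auto simp: dens_def)

lemma dens_mult: "s \<in> dens \<Longrightarrow> t \<in> dens \<Longrightarrow> s \<otimes> t \<in> dens" using I_prime by (auto simp: dens_def)

lemma dens_one: "\<one> \<in> dens" using I_notcarr one_imp_carrier by (auto simp: dens_def)

lemma fraction_rel_iff: "((a,s),(b,t)) \<in> fraction_rel R I \<longleftrightarrow> a \<in> carrier R \<and> s \<in> dens \<and> b \<in> carrier R \<and> t \<in> dens \<and>
   (\<exists>u\<in>dens. u \<otimes> (t \<otimes> a) = u \<otimes> (s \<otimes> b))"
  by (auto simp: fraction_rel_def dens_def)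

lemma equiv_fraction_rel: "equiv (carrier R \<times> dens) (fraction_rel R I)"
proof (rule equivI)
  show "fraction_rel R I \<subseteq> (carrier R \<times> dens) \<times> (carrier R \<times> dens)"
    by (auto simp: fraction_rel_def dens_def)
  show "refl_on (carrier R \<times> dens) (fraction_rel R I)"
    by (rule refl_onI) (use dens_one in \<open>auto simp only: fraction_rel_iff mem_Times_iff split_paired_all fst_conv snd_conv\<close>)
  show "sym (fraction_rel R I)"
  proof (rule symI, clarify)
    fix a s b t assume "((a, s), (b, t)) \<in> fraction_rel R I"
    then obtain u where "a \<in> carrier R" "s \<in> dens" "b \<in> carrier R" "t \<in> dens" "u \<in> dens"
      "u \<otimes> (t \<otimes> a) = u \<otimes> (s \<otimes> b)"
      unfolding fraction_rel_iff by blast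
    then show "((b, t), (a, s)) \<in> fraction_rel R I"
      unfolding fraction_rel_iff by (blast intro: sym)
  qed
  show "trans (fraction_rel R I)"
  proof (rule transI, clarify)
    fix a s b t c v
    assume "((a,s),(b,t)) \<in> fraction_rel R I" "((b,t),(c,v)) \<in> fraction_rel R I"
    then obtain u w where c: "a \<in> carrier R" "s \<in> dens" "b \<in> carrier R" "t \<in> dens" "c \<in> carrier R" "v \<in> dens" "u \<in> dens" "w \<in> dens"
      and 1: "u \<otimes> (t \<otimes> a) = u \<otimes> (s \<otimes> b)" and 2: "w \<otimes> (v \<otimes> b) = w \<otimes> (t \<otimes> c)"
      by (auto simp: fraction_rel_iff)
    note [simp] = c dens_carr
    have "(u \<otimes> w \<otimes> t) \<otimes> (v \<otimes> a) = (w \<otimes> v) \<otimes> (u \<otimes> (t \<otimes> a))" by (simp add: m_ac)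
    also have "\<dots> = (u \<otimes> s) \<otimes> (w \<otimes> (v \<otimes> b))" by (subst 1) (simp add: m_ac)
    also have "\<dots> = (u \<otimes> w \<otimes> t) \<otimes> (s \<otimes> c)" by (subst 2) (simp add: m_ac)
    finally have "(u \<otimes> w \<otimes> t) \<otimes> (v \<otimes> a) = (u \<otimes> w \<otimes> t) \<otimes> (s \<otimes> c)" .
    moreover have "u \<otimes> w \<otimes> t \<in> dens" using c by (intro dens_mult)
    ultimately show "((a, s), (c, v)) \<in> fraction_rel R I"
      unfolding fraction_rel_iff using c by blast
  qed
qed

lemma fraction_eq_iff:
  assumes "a \<in> carrier R" "s \<in> dens" "b \<in> carrier R" "t \<in> dens"
  shows "fraction R I a s = fraction R I b t \<longleftrightarrow> (\<exists>u\<in>dens. u \<otimes> (t \<otimes> a) = u \<otimes> (s \<otimes> b))"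
proof -
  have "(fraction R I a s = fraction R I b t) = (((a,s),(b,t)) \<in> fraction_rel R I)"
    unfolding fraction_def by (rule eq_equiv_class_iff[OF equiv_fraction_rel]) (use assms in simp_all)
  then show ?thesis using assms by (simp only: fraction_rel_iff simp_thms)
qed

lemma fraction_memD: "(b,t) \<in> fraction R I a s \<Longrightarrow> b \<in> carrier R \<and> t \<in> dens \<and> (\<exists>u\<in>dens. u \<otimes> (t \<otimes> a) = u \<otimes> (s \<otimes> b))"
  by (auto simp: fraction_def fraction_rel_iff)

lemma fraction_self: "a \<in> carrier R \<Longrightarrow> s \<in> dens \<Longrightarrow> (a,s) \<in> fraction R I a s"
  by (auto simp: fraction_def fraction_rel_iff intro: dens_one)

lemma localization_mult:
  assumes c: "a \<in> carrier R" "s \<in> dens" "b \<in> carrier R" "t \<in> dens"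
  shows "fraction R I a s \<otimes>\<^bsub>localization R I\<^esub> fraction R I b t = fraction R I (a \<otimes> b) (s \<otimes> t)"
proof -
  have "fraction R I (a' \<otimes> b') (s' \<otimes> t') = fraction R I (a \<otimes> b) (s \<otimes> t)"
    if *: "(a',s') \<in> fraction R I a s" "(b',t') \<in> fraction R I b t" for a' s' b' t'
  proof -
    obtain u v where d: "a' \<in> carrier R" "s' \<in> dens" "b' \<in> carrier R" "t' \<in> dens" "u \<in> dens" "v \<in> dens"
       and 1: "u \<otimes> (s' \<otimes> a) = u \<otimes> (s \<otimes> a')" and 2: "v \<otimes> (t' \<otimes> b) = v \<otimes> (t \<otimes> b')"
      using fraction_memD[OF *(1)] fraction_memD[OF *(2)] by auto
    note [simp] = c d dens_carr
    have "(u \<otimes> v) \<otimes> ((s \<otimes> t) \<otimes> (a' \<otimes> b')) = (u \<otimes> (s \<otimes> a')) \<otimes> (v \<otimes> (t \<otimes> b'))" by (simp add: m_ac)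
    also have "\<dots> = (u \<otimes> (s' \<otimes> a)) \<otimes> (v \<otimes> (t' \<otimes> b))" by (simp only: 1 2)
    also have "\<dots> = (u \<otimes> v) \<otimes> ((s' \<otimes> t') \<otimes> (a \<otimes> b))" by (simp add: m_ac)
    finally show ?thesis using c d by (subst fraction_eq_iff) (auto intro!: dens_mult bexI[of _ "u \<otimes> v"])
  qed
  then show ?thesis unfolding localization_def ring.simps monoid.simps
    by (intro UN2_const[OF fraction_self[OF c(1,2)] fraction_self[OF c(3,4)]])
qed

lemma localization_add:
  assumes c: "a \<in> carrier R" "s \<in> dens" "b \<in> carrier R" "t \<in> dens"
  shows "fraction R I a s \<oplus>\<^bsub>localization R I\<^esub> fraction R I b t = fraction R I (t \<otimes> a \<oplus> s \<otimes> b) (s \<otimes> t)"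
proof -
  have "fraction R I (t' \<otimes> a' \<oplus> s' \<otimes> b') (s' \<otimes> t') = fraction R I (t \<otimes> a \<oplus> s \<otimes> b) (s \<otimes> t)"
    if *: "(a',s') \<in> fraction R I a s" "(b',t') \<in> fraction R I b t" for a' s' b' t'
  proof -
    obtain u v where d: "a' \<in> carrier R" "s' \<in> dens" "b' \<in> carrier R" "t' \<in> dens" "u \<in> dens" "v \<in> dens"
       and 1: "u \<otimes> (s' \<otimes> a) = u \<otimes> (s \<otimes> a')" and 2: "v \<otimes> (t' \<otimes> b) = v \<otimes> (t \<otimes> b')"
      using fraction_memD[OF *(1)] fraction_memD[OF *(2)] by auto
    note [simp] = c d dens_carr
    have "(u \<otimes> v) \<otimes> ((s \<otimes> t) \<otimes> (t' \<otimes> a' \<oplus> s' \<otimes> b')) = (u \<otimes> (s \<otimes> a')) \<otimes> (v \<otimes> t \<otimes> t') \<oplus> (v \<otimes> (t \<otimes> b')) \<otimes> (u \<otimes> s \<otimes> s')" by (simp add: m_ac r_distr)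
    also have "\<dots> = (u \<otimes> (s' \<otimes> a)) \<otimes> (v \<otimes> t \<otimes> t') \<oplus> (v \<otimes> (t' \<otimes> b)) \<otimes> (u \<otimes> s \<otimes> s')" by (simp only: 1 2)
    also have "\<dots> = (u \<otimes> v) \<otimes> ((s' \<otimes> t') \<otimes> (t \<otimes> a \<oplus> s \<otimes> b))" by (simp add: m_ac r_distr)
    finally show ?thesis using c d by (subst fraction_eq_iff) (auto intro!: dens_mult bexI[of _ "u \<otimes> v"])
  qed
  then show ?thesis unfolding localization_def ring.simps monoid.simps
    by (intro UN2_const[OF fraction_self[OF c(1,2)] fraction_self[OF c(3,4)]])
qed

lemma localization_carrier: "carrier (localization R I) = {fraction R I a s | a s. a \<in> carrier R \<and> s \<in> dens}"
  by (auto simp: localization_def quotient_def fraction_def dens_def)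

lemma localization_one: "\<one>\<^bsub>localization R I\<^esub> = fraction R I \<one> \<one>" and localization_zero: "\<zero>\<^bsub>localization R I\<^esub> = fraction R I \<zero> \<one>"
  by (auto simp: localization_def)

lemma fraction_carr: "a \<in> carrier R \<Longrightarrow> s \<in> dens \<Longrightarrow> fraction R I a s \<in> carrier (localization R I)" by (auto simp: localization_carrier)

lemma fraction_eqI: "a \<in> carrier R \<Longrightarrow> s \<in> dens \<Longrightarrow> b \<in> carrier R \<Longrightarrow> t \<in> dens \<Longrightarrow> t \<otimes> a = s \<otimes> b \<Longrightarrow> fraction R I a s = fraction R I b t"
  by (subst fraction_eq_iff) (auto intro!: bexI[OF _ dens_one])

lemma fraction_zero: "s \<in> dens \<Longrightarrow> fraction R I \<zero> s = fraction R I \<zero> \<one>"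
  by (rule fraction_eqI) (auto simp: dens_one dens_carr)

lemma localization_cring: "cring (localization R I)"
proof -
  note [simp] = dens_carr dens_mult dens_one localization_mult localization_add localization_one localization_zero fraction_carr
  let ?L = "localization R I"
  have E: "\<exists>a s. x = fraction R I a s \<and> a \<in> carrier R \<and> s \<in> dens" if "x \<in> carrier ?L" for x
    using that unfolding localization_carrier by blast
  show ?thesis
  proof (rule cringI)
    show "abelian_group ?L"
    proof (rule abelian_groupI)
      fix x y assume "x \<in> carrier ?L" "y \<in> carrier ?L"
      then obtain a s b t where [simp]: "x = fraction R I a s" "a \<in> carrier R" "s \<in> dens" "y = fraction R I b t" "b \<in> carrier R" "t \<in> dens"
        using E by metis
      show "x \<oplus>\<^bsub>?L\<^esub> y \<in> carrier ?L" by simp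
      show "x \<oplus>\<^bsub>?L\<^esub> y = y \<oplus>\<^bsub>?L\<^esub> x" by (simp add: m_comm a_comm)
      fix z assume "z \<in> carrier ?L"
      then obtain c v where [simp]: "z = fraction R I c v" "c \<in> carrier R" "v \<in> dens" using E by metis
      show "x \<oplus>\<^bsub>?L\<^esub> y \<oplus>\<^bsub>?L\<^esub> z = x \<oplus>\<^bsub>?L\<^esub> (y \<oplus>\<^bsub>?L\<^esub> z)"
        by simp (rule fraction_eqI; simp add: m_ac a_ac r_distr)
    next
      fix x assume "x \<in> carrier ?L"
      then obtain a s where [simp]: "x = fraction R I a s" "a \<in> carrier R" "s \<in> dens" using E by metis
      show "\<zero>\<^bsub>?L\<^esub> \<oplus>\<^bsub>?L\<^esub> x = x" by simp
      show "\<exists>y\<in>carrier ?L. y \<oplus>\<^bsub>?L\<^esub> x = \<zero>\<^bsub>?L\<^esub>"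
        by (rule bexI[of _ "fraction R I (\<ominus> a) s"]) (simp_all add: fraction_zero[of "s \<otimes> s"] r_minus l_neg)
    qed simp
    show "comm_monoid ?L"
    proof (rule comm_monoidI)
      fix x y assume "x \<in> carrier ?L" "y \<in> carrier ?L"
      then obtain a s b t where [simp]: "x = fraction R I a s" "a \<in> carrier R" "s \<in> dens" "y = fraction R I b t" "b \<in> carrier R" "t \<in> dens"
        using E by metis
      show "x \<otimes>\<^bsub>?L\<^esub> y \<in> carrier ?L" by simp
      show "x \<otimes>\<^bsub>?L\<^esub> y = y \<otimes>\<^bsub>?L\<^esub> x" by (simp add: m_comm)
      fix z assume "z \<in> carrier ?L"
      then obtain c v where [simp]: "z = fraction R I c v" "c \<in> carrier R" "v \<in> dens" using E by metis
      show "x \<otimes>\<^bsub>?L\<^esub> y \<otimes>\<^bsub>?L\<^esub> z = x \<otimes>\<^bsub>?L\<^esub> (y \<otimes>\<^bsub>?L\<^esub> z)" by (simp add: m_ac)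
    next
      fix x assume "x \<in> carrier ?L"
      then obtain a s where [simp]: "x = fraction R I a s" "a \<in> carrier R" "s \<in> dens" using E by metis
      show "\<one>\<^bsub>?L\<^esub> \<otimes>\<^bsub>?L\<^esub> x = x" by simp
    qed simp
    fix x y z assume "x \<in> carrier ?L" "y \<in> carrier ?L" "z \<in> carrier ?L"
    then obtain a s b t c v where [simp]: "x = fraction R I a s" "a \<in> carrier R" "s \<in> dens" "y = fraction R I b t" "b \<in> carrier R" "t \<in> dens"
      "z = fraction R I c v" "c \<in> carrier R" "v \<in> dens" using E by metis
    show "(x \<oplus>\<^bsub>?L\<^esub> y) \<otimes>\<^bsub>?L\<^esub> z = x \<otimes>\<^bsub>?L\<^esub> z \<oplus>\<^bsub>?L\<^esub> y \<otimes>\<^bsub>?L\<^esub> z"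
      by simp (rule fraction_eqI; simp add: m_ac a_ac r_distr)
  qed
qed

lemma mem_contracted_extended_iff:
  assumes J: "ideal J R" and f: "f \<in> carrier R"
  shows "f \<in> contracted_ideal R I (extended_ideal R I J) \<longleftrightarrow> (\<exists>s\<in>dens. s \<otimes> f \<in> J)"
proof -
  interpret J: ideal J R by fact
  interpret L: cring "localization R I" by (rule localization_cring)
  note [simp] = dens_carr dens_mult dens_one localization_mult localization_add localization_one localization_zero fraction_carr
  let ?E = "{fraction R I a s | a s. a \<in> J \<and> s \<in> dens}"
  have inv: "\<ominus>\<^bsub>localization R I\<^esub> (fraction R I a s) = fraction R I (\<ominus> a) s" if [simp]: "a \<in> carrier R" "s \<in> dens" for a s
    by (rule L.minus_equality) (simp_all add: fraction_zero[of "s \<otimes> s"] r_minus l_neg)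
  have E: "ideal ?E (localization R I)"
  proof (rule idealI)
    show "ring (localization R I)" by unfold_locales
    show "subgroup ?E (add_monoid (localization R I))"
    proof (rule subgroup.intro)
      show "?E \<subseteq> carrier (add_monoid (localization R I))" using J.Icarr fraction_carr by auto
      fix x assume "x \<in> ?E"
      then obtain a s where *: "x = fraction R I a s" "a \<in> J" "s \<in> dens" by blast
      then have "\<ominus>\<^bsub>localization R I\<^esub> x = fraction R I (\<ominus> a) s" using inv J.Icarr by simp
      moreover have "\<ominus> a \<in> J" using * by simp
      ultimately have "\<ominus>\<^bsub>localization R I\<^esub> x \<in> ?E" using * by blast
      then show "inv\<^bsub>add_monoid (localization R I)\<^esub> x \<in> ?E" unfolding a_inv_def .
    next
      fix x y assume "x \<in> ?E" "y \<in> ?E"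
      then obtain a s b t where *: "x = fraction R I a s" "y = fraction R I b t" "a \<in> J" "s \<in> dens" "b \<in> J" "t \<in> dens" by blast
      then have "x \<oplus>\<^bsub>localization R I\<^esub> y = fraction R I (t \<otimes> a \<oplus> s \<otimes> b) (s \<otimes> t)" by (simp add: J.Icarr)
      moreover have "t \<otimes> a \<oplus> s \<otimes> b \<in> J" "s \<otimes> t \<in> dens" using * by (simp_all add: J.I_l_closed)
      ultimately show "x \<otimes>\<^bsub>add_monoid (localization R I)\<^esub> y \<in> ?E" by auto
    next
      show "\<one>\<^bsub>add_monoid (localization R I)\<^esub> \<in> ?E" by (simp, rule exI[of _ \<zero>], rule exI[of _ \<one>]) simp
    qed
  next
    fix x y assume "x \<in> ?E" "y \<in> carrier (localization R I)"
    then obtain a s b t where *: "x = fraction R I a s" "y = fraction R I b t" "a \<in> J" "s \<in> dens" "b \<in> carrier R" "t \<in> dens" unfolding localization_carrier by blast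
    then have "y \<otimes>\<^bsub>localization R I\<^esub> x = fraction R I (b \<otimes> a) (t \<otimes> s)" "x \<otimes>\<^bsub>localization R I\<^esub> y = fraction R I (a \<otimes> b) (s \<otimes> t)"  by (simp_all add: J.Icarr)
    moreover have "b \<otimes> a \<in> J" "a \<otimes> b \<in> J" "s \<otimes> t \<in> dens" "t \<otimes> s \<in> dens" using * by (simp_all add: J.I_l_closed J.I_r_closed)
    ultimately have "y \<otimes>\<^bsub>localization R I\<^esub> x \<in> ?E \<and> x \<otimes>\<^bsub>localization R I\<^esub> y \<in> ?E" by blast
    then show "y \<otimes>\<^bsub>localization R I\<^esub> x \<in> ?E" "x \<otimes>\<^bsub>localization R I\<^esub> y \<in> ?E" by (rule conjunct1, rule conjunct2)
  qed
  have im: "to_localization R I ` J \<subseteq> ?E" unfolding to_localization_def using dens_one by blast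
  have imc: "to_localization R I ` J \<subseteq> carrier (localization R I)" by (auto simp: to_localization_def J.Icarr)
  show ?thesis
  proof
    assume "f \<in> contracted_ideal R I (extended_ideal R I J)"
    then have "fraction R I f \<one> \<in> extended_ideal R I J"
      unfolding contracted_ideal_def to_localization_def by blast
    then have "fraction R I f \<one> \<in> ?E"
      using L.genideal_minimal[OF E im] unfolding extended_ideal_def by (rule rev_subsetD)
    then obtain a s where as: "a \<in> J" "s \<in> dens" "fraction R I f \<one> = fraction R I a s" by blast
    then obtain u where u: "u \<in> dens" "u \<otimes> (s \<otimes> f) = u \<otimes> (\<one> \<otimes> a)"
      using fraction_eq_iff[OF f dens_one J.Icarr[OF as(1)] as(2)] by blast
    note * = as(1,2) u
    have "(u \<otimes> s) \<otimes> f \<in> J" using * f by (simp add: m_assoc J.Icarr J.I_l_closed)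
    then show "\<exists>s\<in>dens. s \<otimes> f \<in> J" using * by (metis dens_mult)
  next
    assume "\<exists>s\<in>dens. s \<otimes> f \<in> J"
    then obtain s where s: "s \<in> dens" "s \<otimes> f \<in> J" by blast
    interpret X: ideal "extended_ideal R I J" "localization R I"
      unfolding extended_ideal_def by (rule L.genideal_ideal[OF imc])
    have "fraction R I (s \<otimes> f) \<one> \<in> extended_ideal R I J"
      using L.genideal_self[OF imc] s unfolding extended_ideal_def to_localization_def by auto
    from X.I_l_closed[OF this fraction_carr[OF one_closed s(1)]]
    have "fraction R I (s \<otimes> f) s \<in> extended_ideal R I J" using s f by simp
    moreover have "fraction R I (s \<otimes> f) s = fraction R I f \<one>" using s f by (intro fraction_eqI) auto
    ultimately show "f \<in> contracted_ideal R I (extended_ideal R I J)"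
      using f by (auto simp: contracted_ideal_def to_localization_def)
  qed
qed

end


section \<open>Associated primes and symbolic powers\<close>

text \<open>The prime ideals that are annihilators of an element of the \<open>R\<close>-module \<open>R / I\<close>.\<close>

definition associated_primes :: "('r, 'm) ring_scheme \<Rightarrow> 'r set \<Rightarrow> 'r set set" where
  "associated_primes R I =
     {p. primeideal p R \<and>
         (\<exists>x\<in>carrier (R Quot I).
            p = {a \<in> carrier R. (I +>\<^bsub>R\<^esub> a) \<otimes>\<^bsub>R Quot I\<^esub> x = \<zero>\<^bsub>R Quot I\<^esub>})}"

text \<open>The power \<open>I [^]\<^bsub>ideals_set R\<^esub> n\<close> is taken in the multiplicative monoid of ideals of \<open>R\<close>.\<close>

definition symbolic_power :: "('r, 'm) ring_scheme \<Rightarrow> 'r set \<Rightarrow> nat \<Rightarrow> 'r set" where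
  "symbolic_power R I n =
     carrier R \<inter>
     (\<Inter>p\<in>associated_primes R I. contracted_ideal R p (extended_ideal R p (I [^]\<^bsub>ideals_set R\<^esub> n)))"


section \<open>Waldschmidt constant\<close>

definition monomial_degree :: "('a \<Rightarrow>\<^sub>0 nat) \<Rightarrow> nat" where
  "monomial_degree m = (\<Sum>x\<in>Poly_Mapping.keys m. Poly_Mapping.lookup m x)"

definition homogeneous :: "nat \<Rightarrow> ('a, 'k::field) poly_in \<Rightarrow> bool" where
  "homogeneous d f \<longleftrightarrow> (\<forall>m\<in>Poly_Mapping.keys f. monomial_degree m = d)"

text \<open>Only meaningful for ideals that contain a nonzero homogeneous element.\<close>

definition initial_degree :: "('a, 'k::field) poly_in set \<Rightarrow> nat" where
  "initial_degree I = (LEAST d. \<exists>f\<in>I. f \<noteq> 0 \<and> homogeneous d f)"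

definition waldschmidt_seq :: "'a set \<Rightarrow> ('a, 'k::field) poly_in set \<Rightarrow> nat \<Rightarrow> real" where
  "waldschmidt_seq X I n = real (initial_degree (symbolic_power (polynomial_ring X) I n)) / real n"

text \<open>As \<^const>\<open>lim\<close> is total, this has to be used together with convergence of the sequence.\<close>

definition waldschmidt_constant :: "'a set \<Rightarrow> ('a, 'k::field) poly_in set \<Rightarrow> real" where
  "waldschmidt_constant X I = lim (waldschmidt_seq X I)"

end

theory Submission
  imports Defs
begin

text \<open>Every part \<open>C\<close> of the partition is a minimal vertex cover, hence generates an associated prime
  \<open>p\<^sub>C\<close> of \<open>I\<close>: it is the annihilator of the product of the variables outside \<open>C\<close>. As
  \<open>I \<subseteq> p\<^sub>C\<close>, and as a polynomial times an element outside \<open>p\<^sub>C\<close> keeps the minimal degree in the variables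
  of \<open>C\<close>, every monomial of an element of \<open>I\<^bsup>(n)\<^esup>\<close> has degree at least \<open>n\<close> in the variables
  of \<open>C\<close>. Summing over the \<open>r\<close> disjoint parts gives degree at least \<open>r n\<close>, and this bound is attained by the
  \<open>n\<close>-th power of any generator.\<close>

section \<open>Minimal weights of products\<close>

lemma minimizers_nonempty:
  fixes w :: "'m \<Rightarrow> nat"
  assumes "A \<noteq> {}"
  shows "{a\<in>A. \<forall>a'\<in>A. w a \<le> w a'} \<noteq> {}"
proof -
  obtain a where "a \<in> A" using assms by blast
  then obtain b where "b \<in> A" "\<forall>a'. a' \<in> A \<longrightarrow> w b \<le> w a'"
    using ex_has_least_nat[of "\<lambda>a. a \<in> A" a w] by blast
  then show ?thesis by blast
qed

text \<open>Takes the place of a monomial order. On passing to the minimizers of the first weight on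
  both sides, additivity forces every competing pair with the same sum to consist of minimizers too;
  the remaining weights are then treated within these smaller sets.\<close>

lemma exists_unique_sum:
  fixes A B :: "'m::plus set" and W :: "('m \<Rightarrow> nat) list"
  assumes "finite A" "A \<noteq> {}" "finite B" "B \<noteq> {}"
    and "\<And>w a b. w \<in> set W \<Longrightarrow> w (a + b) = w a + w b"
  shows "\<exists>a\<in>A. \<exists>b\<in>B. \<forall>a'\<in>A. \<forall>b'\<in>B. a' + b' = a + b \<longrightarrow> (\<forall>w\<in>set W. w a' = w a \<and> w b' = w b)"
  using assms
proof (induction W arbitrary: A B)
  case Nil
  then show ?case by auto
next
  case (Cons w W)
  define A1 where "A1 = {a\<in>A. \<forall>a'\<in>A. w a \<le> w a'}"
  define B1 where "B1 = {b\<in>B. \<forall>b'\<in>B. w b \<le> w b'}"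
  have "A1 \<noteq> {}" "B1 \<noteq> {}"
    unfolding A1_def B1_def using Cons.prems(2,4) by (simp_all only: minimizers_nonempty not_False_eq_True)
  moreover have "finite A1" "finite B1"
    using Cons.prems by (auto simp: A1_def B1_def)
  ultimately obtain a b where ab: "a \<in> A1" "b \<in> B1"
    and uniq: "\<And>a' b' v. a' \<in> A1 \<Longrightarrow> b' \<in> B1 \<Longrightarrow> a' + b' = a + b \<Longrightarrow> v \<in> set W \<Longrightarrow> v a' = v a \<and> v b' = v b"
    using Cons.IH[of A1 B1] Cons.prems(5) by (metis list.set_intros(2))
  have "\<forall>v\<in>set (w # W). v a' = v a \<and> v b' = v b"
    if *: "a' \<in> A" "b' \<in> B" "a' + b' = a + b" for a' b'
  proof -
    have "w a' + w b' = w a + w b"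
      using Cons.prems(5)[of w] *(3) by (metis list.set_intros(1))
    moreover have "w a \<le> w a'" "w b \<le> w b'"
      using ab * by (auto simp: A1_def B1_def)
    ultimately have eq: "w a' = w a" "w b' = w b" by linarith+
    then have "a' \<in> A1" "b' \<in> B1"
      using ab * by (auto simp: A1_def B1_def)
    then show ?thesis using uniq *(3) eq by auto
  qed
  moreover have "a \<in> A" "b \<in> B" using ab by (simp_all add: A1_def B1_def)
  ultimately show ?case by blast
qed

text \<open>An exponent that arises in one way only has as its coefficient a product of two nonzero
  field elements, so nothing can cancel.\<close>

lemma add_in_keys_mult:
  fixes f g :: "'m::cancel_comm_monoid_add \<Rightarrow>\<^sub>0 'k::field"
  assumes a: "a \<in> Poly_Mapping.keys f" and b: "b \<in> Poly_Mapping.keys g"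
    and uniq: "\<And>a' b'. a' \<in> Poly_Mapping.keys f \<Longrightarrow> b' \<in> Poly_Mapping.keys g \<Longrightarrow> a' + b' = a + b \<Longrightarrow> a' = a \<and> b' = b"
  shows "a + b \<in> Poly_Mapping.keys (f * g)"
proof -
  define f' where "f' = f - Poly_Mapping.single a (Poly_Mapping.lookup f a)"
  define g' where "g' = g - Poly_Mapping.single b (Poly_Mapping.lookup g b)"
  have f': "Poly_Mapping.keys f' \<subseteq> Poly_Mapping.keys f - {a}"
    by (auto simp: f'_def in_keys_iff lookup_minus lookup_single when_def split: if_splits)
  have g': "Poly_Mapping.keys g' \<subseteq> Poly_Mapping.keys g - {b}"
    by (auto simp: g'_def in_keys_iff lookup_minus lookup_single when_def split: if_splits)
  \<comment> \<open>The terms at \<open>a\<close> and \<open>b\<close> are split off. The second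
    summand misses \<open>a + b\<close> by cancellation in the exponents, the third one by
    \<open>uniq\<close>.\<close>
  have "f * g = Poly_Mapping.single (a + b) (Poly_Mapping.lookup f a * Poly_Mapping.lookup g b)
      + Poly_Mapping.single a (Poly_Mapping.lookup f a) * g' + f' * g"
    by (simp add: f'_def g'_def algebra_simps mult_single)
  moreover have "a + b \<notin> Poly_Mapping.keys (Poly_Mapping.single a (Poly_Mapping.lookup f a) * g')"
  proof
    assume "a + b \<in> Poly_Mapping.keys (Poly_Mapping.single a (Poly_Mapping.lookup f a) * g')"
    then obtain c d where "a + b = c + d" "c \<in> Poly_Mapping.keys (Poly_Mapping.single a (Poly_Mapping.lookup f a))"
        "d \<in> Poly_Mapping.keys g'"
      using keys_mult by blast
    then show False using g' by (auto split: if_splits)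
  qed
  moreover have "a + b \<notin> Poly_Mapping.keys (f' * g)"
  proof
    assume "a + b \<in> Poly_Mapping.keys (f' * g)"
    then obtain c d where "a + b = c + d" "c \<in> Poly_Mapping.keys f'" "d \<in> Poly_Mapping.keys g"
      using keys_mult by blast
    then show False using f' uniq[of c d] by auto
  qed
  ultimately have "Poly_Mapping.lookup (f * g) (a + b) = Poly_Mapping.lookup f a * Poly_Mapping.lookup g b"
    by (simp add: lookup_add in_keys_iff)
  then show ?thesis using a b by (simp add: in_keys_iff)
qed

text \<open>The product of the lowest weight parts of \<open>f\<close> and \<open>g\<close> does not
  vanish, so lowest weights add under multiplication. For any choice of weight this also excludes
  zero divisors.\<close>

lemma min_weight_in_keys_mult:
  fixes f g :: "('a, 'k::field) poly_in" and w :: "('a \<Rightarrow>\<^sub>0 nat) \<Rightarrow> nat"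
  assumes "f \<noteq> 0" "g \<noteq> 0" and add: "\<And>a b. w (a + b) = w a + w b"
  obtains a b where "a \<in> Poly_Mapping.keys f" "b \<in> Poly_Mapping.keys g" "a + b \<in> Poly_Mapping.keys (f * g)"
    "\<And>a'. a' \<in> Poly_Mapping.keys f \<Longrightarrow> w a \<le> w a'" "\<And>b'. b' \<in> Poly_Mapping.keys g \<Longrightarrow> w b \<le> w b'"
proof -
  \<comment> \<open>The exponents at the finitely many variables that occur in \<open>f\<close> or
    \<open>g\<close> separate their monomials, so they serve as the list of weights.\<close>
  have "finite (\<Union>(Poly_Mapping.keys ` (Poly_Mapping.keys f \<union> Poly_Mapping.keys g)))" by simp
  then obtain vs where vs: "set vs = (\<Union>(Poly_Mapping.keys ` (Poly_Mapping.keys f \<union> Poly_Mapping.keys g)))"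
    by (metis finite_list)
  define A where "A = {a\<in>Poly_Mapping.keys f. \<forall>a'\<in>Poly_Mapping.keys f. w a \<le> w a'}"
  define B where "B = {b\<in>Poly_Mapping.keys g. \<forall>b'\<in>Poly_Mapping.keys g. w b \<le> w b'}"
  have "A \<noteq> {}" "B \<noteq> {}"
    unfolding A_def B_def using assms(1,2) by (simp_all only: minimizers_nonempty keys_eq_empty not_False_eq_True)
  moreover have "finite A" "finite B" by (auto simp: A_def B_def)
  ultimately have "\<exists>a\<in>A. \<exists>b\<in>B. \<forall>a'\<in>A. \<forall>b'\<in>B. a' + b' = a + b \<longrightarrow>
      (\<forall>v\<in>set (map (\<lambda>x m. Poly_Mapping.lookup m x) vs). v a' = v a \<and> v b' = v b)"
    by (intro exists_unique_sum) (auto simp: lookup_add)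
  then obtain a b where ab: "a \<in> A" "b \<in> B"
    and uniq: "\<And>a' b' x. a' \<in> A \<Longrightarrow> b' \<in> B \<Longrightarrow> a' + b' = a + b \<Longrightarrow> x \<in> set vs \<Longrightarrow>
        Poly_Mapping.lookup a' x = Poly_Mapping.lookup a x \<and> Poly_Mapping.lookup b' x = Poly_Mapping.lookup b x"
    unfolding list.set_map ball_simps(9) by blast
  \<comment> \<open>So far the pair is unique only among the minimizers \<open>A\<close> and
    \<open>B\<close>. Additivity of \<open>w\<close> extends this to all monomials, since a pair
    with the same sum consists of minimizers.\<close>
  have "a + b \<in> Poly_Mapping.keys (f * g)"
  proof (rule add_in_keys_mult)
    fix a' b' assume *: "a' \<in> Poly_Mapping.keys f" "b' \<in> Poly_Mapping.keys g" "a' + b' = a + b"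
    have "w a' + w b' = w a + w b" using *(3) add by metis
    moreover have "w a \<le> w a'" "w b \<le> w b'" using ab * by (auto simp: A_def B_def)
    ultimately have "w a' = w a" "w b' = w b" by linarith+
    then have AB: "a' \<in> A" "b' \<in> B" using ab * by (auto simp: A_def B_def)
    have outside: "Poly_Mapping.lookup m x = 0"
      if "x \<notin> set vs" "m \<in> Poly_Mapping.keys f \<union> Poly_Mapping.keys g" for x m
      using that vs by (auto simp: in_keys_iff)
    have "Poly_Mapping.lookup a' x = Poly_Mapping.lookup a x \<and> Poly_Mapping.lookup b' x = Poly_Mapping.lookup b x" for x
    proof (cases "x \<in> set vs")
      case True
      then show ?thesis using uniq AB *(3) by blast
    next
      case False
      then show ?thesis using * ab by (simp add: outside A_def B_def)
    qed
    then show "a' = a \<and> b' = b" by (auto intro: poly_mapping_eqI)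
  qed (use ab in \<open>auto simp: A_def B_def\<close>)
  with ab show thesis by (intro that[of a b]) (auto simp: A_def B_def)
qed


section \<open>Powers of the prime generated by a set of variables\<close>

text \<open>The degree in the variables of \<open>C\<close>. For infinite \<open>C\<close> the sum
  defaults to 0, and additivity still holds.\<close>

definition weight :: "'a set \<Rightarrow> ('a \<Rightarrow>\<^sub>0 nat) \<Rightarrow> nat" where
  "weight C m = (\<Sum>x\<in>C. Poly_Mapping.lookup m x)"

lemma weight_zero [simp]: "weight C 0 = 0"
  by (simp add: weight_def)

lemma weight_add: "weight C (a + b) = weight C a + weight C b"
  by (simp add: weight_def lookup_add sum.distrib)

lemma weight_sum_single: "finite C \<Longrightarrow> finite E \<Longrightarrow> weight C (\<Sum>x\<in>E. Poly_Mapping.single x (Suc 0)) = card (C \<inter> E)"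
  by (simp add: weight_def lookup_sum lookup_single when_def sum.If_cases Int_def)

text \<open>For \<open>C \<subseteq> X\<close> this is the \<open>n\<close>-th power of the prime ideal generated by the variables in \<open>C\<close>.\<close>

definition weight_ideal :: "'a set \<Rightarrow> 'a set \<Rightarrow> nat \<Rightarrow> ('a, 'k::field) poly_in set" where
  "weight_ideal X C n = {f \<in> carrier (polynomial_ring X). \<forall>m\<in>Poly_Mapping.keys f. n \<le> weight C m}"

lemma polynomial_ring_simps [simp]:
  "f \<in> carrier (polynomial_ring X) \<longleftrightarrow> (\<forall>m\<in>Poly_Mapping.keys f. Poly_Mapping.keys m \<subseteq> X)"
  "f \<oplus>\<^bsub>polynomial_ring X\<^esub> g = f + g" "f \<otimes>\<^bsub>polynomial_ring X\<^esub> g = f * g"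
  "\<zero>\<^bsub>polynomial_ring X\<^esub> = 0" "\<one>\<^bsub>polynomial_ring X\<^esub> = 1"
  for f g :: "('a, 'k::field) poly_in"
  by (simp_all add: polynomial_ring_def)

lemma mult_mem_weight_ideal:
  assumes "f \<in> weight_ideal X C m" "g \<in> weight_ideal X C n"
  shows "f * g \<in> weight_ideal X C (m + n)"
proof -
  have "Poly_Mapping.keys c \<subseteq> X \<and> m + n \<le> weight C c" if c: "c \<in> Poly_Mapping.keys (f * g)" for c
  proof -
    obtain a b where ab: "c = a + b" "a \<in> Poly_Mapping.keys f" "b \<in> Poly_Mapping.keys g"
      using c keys_mult[of f g] by blast
    then have "Poly_Mapping.keys a \<subseteq> X" "Poly_Mapping.keys b \<subseteq> X" "m \<le> weight C a" "n \<le> weight C b"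
      using assms by (auto simp: weight_ideal_def)
    then show ?thesis using keys_add[of a b] by (auto simp: ab(1) weight_add)
  qed
  then show ?thesis by (auto simp: weight_ideal_def)
qed

lemma weight_ideal_0: "weight_ideal X C 0 = carrier (polynomial_ring X)"
  by (simp add: weight_ideal_def polynomial_ring_def)

lemma ideal_weight_ideal: "ideal (weight_ideal X C n) (polynomial_ring X :: ('a, 'k::field) poly_in ring)"
proof -
  interpret R: cring "polynomial_ring X :: ('a, 'k) poly_in ring" by (rule polynomial_ring_cring)
  have minus: "\<ominus>\<^bsub>polynomial_ring X\<^esub> f = - f" if "f \<in> carrier (polynomial_ring X)"
    for f :: "('a, 'k) poly_in"
    using that by (intro R.minus_equality) simp_all
  show ?thesis
  proof (rule idealI)
    show "ring (polynomial_ring X :: ('a, 'k) poly_in ring)" by (rule R.ring_axioms)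
    show "subgroup (weight_ideal X C n :: ('a, 'k) poly_in set) (add_monoid (polynomial_ring X))"
    proof (rule R.add.subgroupI)
      fix f assume f: "f \<in> (weight_ideal X C n :: ('a, 'k) poly_in set)"
      then show "\<ominus>\<^bsub>polynomial_ring X\<^esub> f \<in> weight_ideal X C n"
        using minus[of f] by (simp add: weight_ideal_def)
      fix g assume g: "g \<in> (weight_ideal X C n :: ('a, 'k) poly_in set)"
      show "f \<oplus>\<^bsub>polynomial_ring X\<^esub> g \<in> weight_ideal X C n"
        using f g keys_add[of f g] by (fastforce simp: weight_ideal_def)
    qed (auto simp: weight_ideal_def intro!: exI[of _ 0])
    fix f g :: "('a, 'k) poly_in"
    assume fg: "f \<in> weight_ideal X C n" "g \<in> carrier (polynomial_ring X)"
    \<comment> \<open>An arbitrary ring element counts as a factor of weight at least 0, so the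
      product rule gives absorption.\<close>
    show "f \<otimes>\<^bsub>polynomial_ring X\<^esub> g \<in> weight_ideal X C n"
      using mult_mem_weight_ideal[of f X C n g 0] fg by (simp add: weight_ideal_0)
    then show "g \<otimes>\<^bsub>polynomial_ring X\<^esub> f \<in> weight_ideal X C n" by (simp add: mult.commute)
  qed
qed

text \<open>An \<open>s\<close> outside the prime has a monomial of weight 0, so its lowest weight
  is 0; as lowest weights add, \<open>s * f\<close> and a nonzero \<open>f\<close> have the same
  one. Thus \<open>weight_ideal X C n\<close> is its own contraction from the localization at
  \<open>weight_ideal X C 1\<close>.\<close>

lemma weight_ideal_cancel:
  fixes s f :: "('a, 'k::field) poly_in"
  assumes "s \<in> carrier (polynomial_ring X)" "s \<notin> weight_ideal X C 1"
    and f: "f \<in> carrier (polynomial_ring X)" and sf: "s * f \<in> weight_ideal X C n"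
  shows "f \<in> weight_ideal X C n"
proof (cases "f = 0")
  case False
  obtain c where c: "c \<in> Poly_Mapping.keys s" "weight C c = 0"
    using assms(1,2) by (force simp: weight_ideal_def)
  then have "s \<noteq> 0" by auto
  then obtain a b where "a + b \<in> Poly_Mapping.keys (s * f)" and a: "a \<in> Poly_Mapping.keys s"
      "\<And>a'. a' \<in> Poly_Mapping.keys s \<Longrightarrow> weight C a \<le> weight C a'"
    and b: "\<And>b'. b' \<in> Poly_Mapping.keys f \<Longrightarrow> weight C b \<le> weight C b'"
    using False by (rule min_weight_in_keys_mult[of s f "weight C"]) (auto simp: weight_add)
  then have "n \<le> weight C a + weight C b"
    using sf by (auto simp: weight_ideal_def weight_add)
  moreover have "weight C a = 0" using a(2)[OF c(1)] c(2) by simp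
  ultimately show ?thesis using f b by (fastforce simp: weight_ideal_def)
qed (simp add: weight_ideal_def)

text \<open>Properness holds because the monomial of \<open>1\<close> has weight 0; primality is the
  cancellation above for \<open>n = 1\<close>.\<close>

lemma primeideal_weight_ideal: "primeideal (weight_ideal X C 1) (polynomial_ring X :: ('a, 'k::field) poly_in ring)"
proof (rule primeidealI[OF ideal_weight_ideal polynomial_ring_cring])
  have "1 \<in> carrier (polynomial_ring X)" "1 \<notin> weight_ideal X C 1"
    by (simp_all add: weight_ideal_def)
  then show "carrier (polynomial_ring X) \<noteq> (weight_ideal X C 1 :: ('a, 'k) poly_in set)" by metis
  fix a b :: "('a, 'k) poly_in"
  assume ab: "a \<in> carrier (polynomial_ring X)" "b \<in> carrier (polynomial_ring X)"
    "a \<otimes>\<^bsub>polynomial_ring X\<^esub> b \<in> weight_ideal X C 1"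
  then have "a * b \<in> weight_ideal X C 1" by simp
  then show "a \<in> weight_ideal X C 1 \<or> b \<in> weight_ideal X C 1"
    using weight_ideal_cancel[OF ab(1) _ ab(2)] by blast
qed


section \<open>Symbolic powers of edge ideals\<close>

lemma (in ring) ideal_ideals_set_pow:
  assumes "ideal I R"
  shows "ideal (I [^]\<^bsub>ideals_set R\<^esub> (n::nat)) R"
  by (induction n) (use assms in \<open>simp_all add: nat_pow_def ideals_set_def oneideal ideal_prod_is_ideal\<close>)

lemma (in ring) pow_mem_ideals_set_pow:
  assumes "x \<in> I"
  shows "x [^] n \<in> I [^]\<^bsub>ideals_set R\<^esub> (n::nat)"
  by (induction n) (use assms in \<open>simp_all add: nat_pow_def ideals_set_def ideal_prod.prod\<close>)

text \<open>Elements of an ideal product are sums of products of two factors; weight bounds add over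
  factors and survive sums.\<close>

lemma ideals_set_pow_subset_weight_ideal:
  fixes I :: "('a, 'k::field) poly_in set"
  assumes "I \<subseteq> weight_ideal X C 1"
  shows "I [^]\<^bsub>ideals_set (polynomial_ring X)\<^esub> n \<subseteq> weight_ideal X C n"
proof (induction n)
  case 0
  then show ?case by (simp add: nat_pow_def ideals_set_def weight_ideal_0)
next
  case (Suc n)
  interpret J: ideal "weight_ideal X C (Suc n)" "polynomial_ring X :: ('a, 'k) poly_in ring"
    by (rule ideal_weight_ideal)
  show ?case
  proof
    fix f assume "f \<in> I [^]\<^bsub>ideals_set (polynomial_ring X)\<^esub> Suc n"
    then have "f \<in> (I [^]\<^bsub>ideals_set (polynomial_ring X)\<^esub> n) \<cdot>\<^bsub>polynomial_ring X\<^esub> I"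
      by (simp add: nat_pow_def ideals_set_def)
    then show "f \<in> weight_ideal X C (Suc n)"
    proof (induction rule: ideal_prod.induct)
      case (prod g h)
      then show ?case using mult_mem_weight_ideal[of g X C n h 1] Suc.IH assms by auto
    next
      case (sum g h)
      then show ?case using J.a_closed by blast
    qed
  qed
qed

section \<open>Squarefree monomials\<close>

lemma prod_var: "finite E \<Longrightarrow> (\<Prod>x\<in>E. var x) = Poly_Mapping.single (\<Sum>x\<in>E. Poly_Mapping.single x (Suc 0)) 1"
  by (induction E rule: finite_induct) (simp_all add: var_def mult_single single_one)

lemma keys_sum_single: "finite E \<Longrightarrow> Poly_Mapping.keys (\<Sum>x\<in>E. Poly_Mapping.single x (Suc 0)) = E"
  by (auto simp: in_keys_iff lookup_sum lookup_single when_def split: if_splits)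

lemma prod_var_mem_carrier: "finite E \<Longrightarrow> (\<Prod>x\<in>E. var x :: ('a, 'k::field) poly_in) \<in> carrier (polynomial_ring X) \<longleftrightarrow> E \<subseteq> X"
  by (simp add: prod_var keys_sum_single)

lemma prod_var_mem_weight_ideal:
  assumes "finite E" "finite C"
  shows "(\<Prod>x\<in>E. var x :: ('a, 'k::field) poly_in) \<in> weight_ideal X C n \<longleftrightarrow> E \<subseteq> X \<and> n \<le> card (C \<inter> E)"
  using assms by (simp add: weight_ideal_def prod_var keys_sum_single weight_sum_single)

section \<open>Edge ideals: associated primes and symbolic powers\<close>

context
  fixes X :: "'a set" and H :: "'a set set"
  assumes finite_vertices: "finite X" and edges_subset: "\<And>E. E \<in> H \<Longrightarrow> E \<subseteq> X"
begin

lemma finite_edge: "E \<in> H \<Longrightarrow> finite E"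
  using edges_subset finite_vertices finite_subset by blast

lemma edge_products_subset: "(\<lambda>E. \<Prod>x\<in>E. var x) ` H \<subseteq> carrier (polynomial_ring X :: ('a, 'k::field) poly_in ring)"
  by (rule image_subsetI) (use prod_var_mem_carrier[OF finite_edge] edges_subset in metis)

lemma ideal_edge_ideal: "ideal (edge_ideal X H) (polynomial_ring X :: ('a, 'k::field) poly_in ring)"
proof -
  interpret R: cring "polynomial_ring X :: ('a, 'k) poly_in ring" by (rule polynomial_ring_cring)
  show ?thesis unfolding edge_ideal_def by (rule R.genideal_ideal[OF edge_products_subset])
qed

lemma edge_product_mem:
  assumes "E \<in> H"
  shows "(\<Prod>x\<in>E. var x) \<in> (edge_ideal X H :: ('a, 'k::field) poly_in set)"
proof -
  interpret R: cring "polynomial_ring X :: ('a, 'k) poly_in ring" by (rule polynomial_ring_cring)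
  show ?thesis unfolding edge_ideal_def using R.genideal_self[OF edge_products_subset] assms by blast
qed

text \<open>A cover puts at least one of its variables into every generator.\<close>

lemma edge_ideal_subset_weight_ideal:
  assumes "vertex_cover X H C"
  shows "(edge_ideal X H :: ('a, 'k::field) poly_in set) \<subseteq> weight_ideal X C 1"
proof -
  interpret R: cring "polynomial_ring X :: ('a, 'k) poly_in ring" by (rule polynomial_ring_cring)
  have C: "finite C" using assms finite_vertices finite_subset by (auto simp: vertex_cover_def)
  have "(\<Prod>x\<in>E. var x :: ('a, 'k) poly_in) \<in> weight_ideal X C 1" if "E \<in> H" for E
  proof -
    have "1 \<le> card (C \<inter> E)" using that assms C by (simp add: vertex_cover_def Suc_le_eq card_gt_0_iff)
    then show ?thesis using prod_var_mem_weight_ideal[OF finite_edge[OF that] C] edges_subset[OF that] by blast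
  qed
  then show ?thesis unfolding edge_ideal_def
    by (intro R.genideal_minimal[OF ideal_weight_ideal]) blast
qed

text \<open>The condition \<open>critical\<close> expresses that the cover \<open>C\<close> is
  minimal. Let \<open>q\<close> be the product of the variables outside \<open>C\<close>. As
  \<open>q\<close> lies outside the prime and the edge ideal inside, \<open>a * q\<close> in the
  edge ideal puts \<open>a\<close> into the prime. Conversely, if \<open>C \<inter> E = {x}\<close>,
  then the generator of \<open>E\<close> divides \<open>var x * q\<close>.\<close>

lemma weight_ideal_associated_prime:
  assumes C: "vertex_cover X H C"
    and critical: "\<And>x. x \<in> C \<Longrightarrow> \<exists>E\<in>H. C \<inter> E = {x}"
  shows "weight_ideal X C 1 \<in> associated_primes (polynomial_ring X) (edge_ideal X H :: ('a, 'k::field) poly_in set)"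
proof -
  let ?R = "polynomial_ring X :: ('a, 'k) poly_in ring"
  let ?I = "edge_ideal X H :: ('a, 'k) poly_in set"
  define q :: "('a, 'k) poly_in" where "q = (\<Prod>x\<in>X - C. var x)"
  interpret R: cring ?R by (rule polynomial_ring_cring)
  interpret I: ideal ?I ?R by (rule ideal_edge_ideal)
  have fin: "finite C" using C finite_vertices finite_subset by (auto simp: vertex_cover_def)
  have q: "q \<in> carrier ?R" unfolding q_def using finite_vertices by (subst prod_var_mem_carrier) auto
  have q_notin: "q \<notin> weight_ideal X C 1"
    using finite_vertices fin by (simp add: q_def prod_var_mem_weight_ideal)
  have ann: "a * q \<in> ?I \<longleftrightarrow> a \<in> weight_ideal X C 1" if a: "a \<in> carrier ?R" for a
  proof
    assume "a * q \<in> ?I"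
    then have "q * a \<in> weight_ideal X C 1"
      using edge_ideal_subset_weight_ideal[OF C] by (auto simp: mult.commute)
    then show "a \<in> weight_ideal X C 1" by (rule weight_ideal_cancel[OF q q_notin a])
  next
    assume aw: "a \<in> weight_ideal X C 1"
    \<comment> \<open>Treats the single terms of \<open>a\<close>; each of them contains a variable
      of \<open>C\<close>.\<close>
    have mono: "Poly_Mapping.single m c * q \<in> ?I" if m: "Poly_Mapping.keys m \<subseteq> X" "1 \<le> weight C m" for m and c :: 'k
    proof -
      have "\<exists>x\<in>C. Poly_Mapping.lookup m x \<noteq> 0"
      proof (rule ccontr)
        assume "\<not> (\<exists>x\<in>C. Poly_Mapping.lookup m x \<noteq> 0)"
        then have "weight C m = 0" by (simp add: weight_def)
        with m show False by simp
      qed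
      then obtain x where x: "x \<in> C" "Poly_Mapping.lookup m x \<noteq> 0" by blast
      obtain E where E: "E \<in> H" "C \<inter> E = {x}" using critical x(1) by blast
      \<comment> \<open>One factor \<open>x\<close> is taken out of \<open>m\<close>; the truncated
        subtraction is exact because the exponent of \<open>x\<close> is nonzero.\<close>
      define m' where "m' = m - Poly_Mapping.single x 1"
      have m': "m = m' + Poly_Mapping.single x 1"
        using x(2) by (intro poly_mapping_eqI) (auto simp: m'_def lookup_minus lookup_add lookup_single when_def)
      have km': "Poly_Mapping.keys m' \<subseteq> X"
        using m(1) by (auto simp: m'_def in_keys_iff lookup_minus lookup_single when_def split: if_splits)
      have xE: "x \<in> E" using E by auto
      \<comment> \<open>As \<open>x\<close> is the only vertex of \<open>E\<close> in
        \<open>C\<close>, all the others occur in \<open>q\<close>; with the factor \<open>x\<close>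
        taken from \<open>m\<close> they make up the generator of \<open>E\<close>.\<close>
      have sub: "E - {x} \<subseteq> X - C" using E edges_subset[OF E(1)] by auto
      have "q = (\<Prod>y\<in>X - C - (E - {x}). var y) * (\<Prod>y\<in>E - {x}. var y)"
        unfolding q_def using finite_vertices by (intro prod.subset_diff[OF sub]) simp
      moreover have "(\<Prod>y\<in>E. var y) = var x * (\<Prod>y\<in>E - {x}. var y :: ('a, 'k) poly_in)"
        using finite_edge[OF E(1)] xE by (rule prod.remove)
      moreover have "Poly_Mapping.single m c = Poly_Mapping.single m' c * var x"
        by (simp add: m' var_def mult_single)
      ultimately have eq: "Poly_Mapping.single m c * q
          = (Poly_Mapping.single m' c * (\<Prod>y\<in>X - C - (E - {x}). var y)) * (\<Prod>y\<in>E. var y)"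
        by (simp add: ac_simps)
      have "Poly_Mapping.single m' c \<in> carrier ?R" using km' by simp
      moreover have "(\<Prod>y\<in>X - C - (E - {x}). var y) \<in> carrier ?R"
        using finite_vertices by (subst prod_var_mem_carrier) auto
      ultimately have "Poly_Mapping.single m' c * (\<Prod>y\<in>X - C - (E - {x}). var y) \<in> carrier ?R"
        using R.m_closed by (metis polynomial_ring_simps(3))
      then show ?thesis
        using I.I_l_closed[OF edge_product_mem[OF E(1)]] eq by (metis polynomial_ring_simps(3))
    qed
    \<comment> \<open>Keeping \<open>M\<close> among the monomials of \<open>a\<close> preserves the
      weight bound in the induction; the full set of monomials yields \<open>a * q\<close>.\<close>
    have "(\<Sum>m\<in>M. Poly_Mapping.single m (Poly_Mapping.lookup a m) * q) \<in> ?I"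
      if "finite M" "M \<subseteq> Poly_Mapping.keys a" for M
      using that
    proof (induction M rule: finite_induct)
      case empty
      then show ?case using I.zero_closed by simp
    next
      case (insert m M)
      have "Poly_Mapping.single m (Poly_Mapping.lookup a m) * q \<in> ?I"
        using insert.prems aw by (intro mono) (auto simp: weight_ideal_def)
      then show ?case using I.a_closed insert by fastforce
    qed
    from this[OF finite_keys order_refl]
    have "(\<Sum>m\<in>Poly_Mapping.keys a. Poly_Mapping.single m (Poly_Mapping.lookup a m)) * q \<in> ?I"
      by (simp only: sum_distrib_right)
    moreover have "a = (\<Sum>m\<in>Poly_Mapping.keys a. Poly_Mapping.single m (Poly_Mapping.lookup a m))"
      by (rule poly_mapping_eqI) (auto simp: lookup_sum lookup_single when_def in_keys_iff)
    ultimately show "a * q \<in> ?I" by metis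
  qed
  \<comment> \<open>The coset of \<open>q\<close> is the witness: in the quotient ring the
    annihilator condition reads \<open>a * q \<in> ?I\<close>.\<close>
  have "weight_ideal X C 1 = {a \<in> carrier ?R. (?I +>\<^bsub>?R\<^esub> a) \<otimes>\<^bsub>?R Quot ?I\<^esub> (?I +>\<^bsub>?R\<^esub> q) = \<zero>\<^bsub>?R Quot ?I\<^esub>}"
  proof -
    have "(?I +>\<^bsub>?R\<^esub> a) \<otimes>\<^bsub>?R Quot ?I\<^esub> (?I +>\<^bsub>?R\<^esub> q) = \<zero>\<^bsub>?R Quot ?I\<^esub> \<longleftrightarrow> a \<in> weight_ideal X C 1"
      if a: "a \<in> carrier ?R" for a
    proof -
      have aq: "a * q \<in> carrier ?R" using R.m_closed[OF a q] by simp
      have "(?I +>\<^bsub>?R\<^esub> a) \<otimes>\<^bsub>?R Quot ?I\<^esub> (?I +>\<^bsub>?R\<^esub> q) = ?I +>\<^bsub>?R\<^esub> (a * q)"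
        using I.rcoset_mult_add[OF a q] by (simp add: FactRing_def)
      moreover have "?I +>\<^bsub>?R\<^esub> (a * q) = ?I \<longleftrightarrow> a * q \<in> ?I"
        using aq I.a_rcos_self I.a_rcos_const by metis
      ultimately show ?thesis using ann[OF a] by (simp add: FactRing_def)
    qed
    then show ?thesis by (auto simp: weight_ideal_def)
  qed
  moreover have "?I +>\<^bsub>?R\<^esub> q \<in> carrier (?R Quot ?I)"
    using R.a_rcosetsI[OF I.a_subset q] by (simp add: FactRing_def)
  ultimately show ?thesis
    unfolding associated_primes_def using primeideal_weight_ideal by blast
qed

text \<open>Localizing at the prime of \<open>C\<close> supplies some \<open>s\<close> outside it
  with \<open>s * f\<close> in the ordinary power. That power lies in the weight ideal, from which
  \<open>s\<close> can be cancelled.\<close>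

lemma symbolic_power_subset_weight_ideal:
  assumes C: "vertex_cover X H C"
    and critical: "\<And>x. x \<in> C \<Longrightarrow> \<exists>E\<in>H. C \<inter> E = {x}"
  shows "symbolic_power (polynomial_ring X) (edge_ideal X H :: ('a, 'k::field) poly_in set) n \<subseteq> weight_ideal X C n"
proof
  let ?R = "polynomial_ring X :: ('a, 'k) poly_in ring"
  let ?I = "edge_ideal X H :: ('a, 'k) poly_in set"
  let ?p = "weight_ideal X C 1 :: ('a, 'k) poly_in set"
  interpret p: primeideal ?p ?R by (rule primeideal_weight_ideal)
  fix f assume f: "f \<in> symbolic_power ?R ?I n"
  then have fR: "f \<in> carrier ?R" unfolding symbolic_power_def by blast
  have "f \<in> contracted_ideal ?R ?p (extended_ideal ?R ?p (?I [^]\<^bsub>ideals_set ?R\<^esub> n))"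
    using f weight_ideal_associated_prime[OF assms] unfolding symbolic_power_def by blast
  then obtain s where s: "s \<in> p.dens" and sf: "s * f \<in> ?I [^]\<^bsub>ideals_set ?R\<^esub> n"
    using p.mem_contracted_extended_iff[OF p.ideal_ideals_set_pow[OF ideal_edge_ideal] fR]
    by (metis polynomial_ring_simps(3))
  have "s \<in> carrier ?R" "s \<notin> ?p" using s unfolding p.dens_def by blast+
  moreover have "s * f \<in> weight_ideal X C n"
    using sf ideals_set_pow_subset_weight_ideal[OF edge_ideal_subset_weight_ideal[OF C]] by blast
  ultimately show "f \<in> weight_ideal X C n" by (rule weight_ideal_cancel[OF _ _ fR])
qed

text \<open>The denominator \<open>1\<close> puts every element of the power into each
  contraction.\<close>

lemma power_subset_symbolic_power:
  "(edge_ideal X H :: ('a, 'k::field) poly_in set) [^]\<^bsub>ideals_set (polynomial_ring X)\<^esub> n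
    \<subseteq> symbolic_power (polynomial_ring X) (edge_ideal X H) n"
proof
  let ?R = "polynomial_ring X :: ('a, 'k) poly_in ring"
  let ?I = "edge_ideal X H :: ('a, 'k) poly_in set"
  interpret R: cring ?R by (rule polynomial_ring_cring)
  interpret J: ideal "?I [^]\<^bsub>ideals_set ?R\<^esub> n" ?R by (rule R.ideal_ideals_set_pow[OF ideal_edge_ideal])
  fix f assume f: "f \<in> ?I [^]\<^bsub>ideals_set ?R\<^esub> n"
  then have fR: "f \<in> carrier ?R" by (rule J.Icarr)
  have "f \<in> contracted_ideal ?R p (extended_ideal ?R p (?I [^]\<^bsub>ideals_set ?R\<^esub> n))"
    if "p \<in> associated_primes ?R ?I" for p
  proof -
    interpret p: primeideal p ?R using that by (simp add: associated_primes_def)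
    show ?thesis
      using p.mem_contracted_extended_iff[OF J.ideal_axioms fR] p.dens_one f R.l_one[OF fR] by metis
  qed
  then show "f \<in> symbolic_power ?R ?I n" using fR unfolding symbolic_power_def by blast
qed

end

section \<open>Degrees and homogeneous polynomials\<close>

lemma monomial_degree_eq_weight:
  assumes "finite X" "Poly_Mapping.keys m \<subseteq> X"
  shows "monomial_degree m = weight X m"
  unfolding monomial_degree_def weight_def using assms by (intro sum.mono_neutral_left) (auto simp: in_keys_iff)

lemma homogeneous_1: "homogeneous 0 1"
  by (simp add: homogeneous_def monomial_degree_def)

lemma homogeneous_mult:
  assumes "homogeneous d f" "homogeneous e g"
  shows "homogeneous (d + e) (f * g)"
proof -
  \<comment> \<open>The supports differ, so all three degrees are computed as weights over the union
    of the supports, where additivity is known.\<close>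
  have "monomial_degree (a + b) = monomial_degree a + monomial_degree b" for a b :: "'a \<Rightarrow>\<^sub>0 nat"
    using keys_add[of a b] by (simp add: weight_add monomial_degree_eq_weight[of "Poly_Mapping.keys a \<union> Poly_Mapping.keys b"])
  then show ?thesis using assms keys_mult[of f g] by (fastforce simp: homogeneous_def)
qed

lemma homogeneous_power: "homogeneous d f \<Longrightarrow> homogeneous (d * n) (f ^ n)"
  by (induction n) (simp_all add: homogeneous_1 homogeneous_mult)

lemma homogeneous_prod_var: "finite E \<Longrightarrow> homogeneous (card E) (\<Prod>x\<in>E. var x)"
  by (simp add: homogeneous_def prod_var monomial_degree_eq_weight[of E] keys_sum_single weight_sum_single)

lemma power_nonzero:
  fixes f :: "('a, 'k::field) poly_in"
  assumes "f \<noteq> 0"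
  shows "f ^ n \<noteq> 0"
proof (induction n)
  case (Suc n)
  show ?case
    \<comment> \<open>The zero weight leaves only the statement that the product has a
      monomial.\<close>
    by (rule min_weight_in_keys_mult[OF assms Suc, of "\<lambda>_. 0"]) auto
qed simp

section \<open>Initial degrees of the symbolic powers, and the limit\<close>

theorem proposition1p2:
  fixes X :: "'a set" and H :: "'a set set" and r :: nat
    and I :: "('a, 'k::field) poly_in set"
  assumes "simple_hypergraph X H"
    and "H \<noteq> {}"
    and "uniform_hypergraph r H"
    and "partite_hypergraph r X H"
    and "I = edge_ideal X H"
  shows "convergent (waldschmidt_seq X I) \<and> waldschmidt_constant X I = real r"
proof -
  let ?R = "polynomial_ring X :: ('a, 'k) poly_in ring"
  have X: "finite X" "\<And>E. E \<in> H \<Longrightarrow> E \<subseteq> X" "\<Union>H = X"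
    using assms(1) by (auto simp: simple_hypergraph_def)
  interpret R: cring ?R by (rule polynomial_ring_cring)
  obtain P where P: "X = (\<Union>i\<in>{1..r}. P i)"
    and disjoint: "\<forall>i\<in>{1..r}. \<forall>j\<in>{1..r}. i \<noteq> j \<longrightarrow> P i \<inter> P j = {}"
    and cover: "\<forall>i\<in>{1..r}. vertex_cover X H (P i)"
    and meets_once: "\<forall>i\<in>{1..r}. \<forall>E\<in>H. card (P i \<inter> E) = 1"
    using assms(4) unfolding partite_hypergraph_def by (elim exE conjE) (rule that)
  obtain E where E: "E \<in> H" using assms(2) by blast
  have finE: "finite E" using X E finite_subset by blast
  have degree: "initial_degree (symbolic_power ?R I n) = r * n" for n
    unfolding initial_degree_def
  proof (rule Least_equality)
    let ?f = "(\<Prod>x\<in>E. var x) ^ n :: ('a, 'k) poly_in"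
    have pow: "g [^]\<^bsub>?R\<^esub> n = g ^ n" for g
      by (induction n) (simp_all add: nat_pow_def mult.commute)
    have "(\<Prod>x\<in>E. var x) [^]\<^bsub>?R\<^esub> n \<in> I [^]\<^bsub>ideals_set ?R\<^esub> n"
      using R.pow_mem_ideals_set_pow edge_product_mem[OF X(1,2) E] assms(5) by blast
    then have "?f \<in> symbolic_power ?R I n"
      using power_subset_symbolic_power[OF X(1,2)] assms(5) pow by auto
    moreover have "?f \<noteq> 0"
      using finE by (intro power_nonzero) (simp add: prod_var flip: keys_eq_empty)
    moreover have "homogeneous (r * n) ?f"
      using homogeneous_power[OF homogeneous_prod_var[OF finE]] assms(3) E
      by (simp add: uniform_hypergraph_def)
    ultimately show "\<exists>f\<in>symbolic_power ?R I n. f \<noteq> 0 \<and> homogeneous (r * n) f" by blast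
  next
    fix d assume "\<exists>f\<in>symbolic_power ?R I n. f \<noteq> 0 \<and> homogeneous d f"
    then obtain f where f: "f \<in> symbolic_power ?R I n" "f \<noteq> 0" "homogeneous d f" by blast
    \<comment> \<open>Any monomial will do: by homogeneity each one has degree
      \<open>d\<close>.\<close>
    then obtain m where m: "m \<in> Poly_Mapping.keys f" using keys_eq_empty by blast
    have "f \<in> weight_ideal X (P i) n" if i: "i \<in> {1..r}" for i
    proof -
      \<comment> \<open>Minimality of the part as a cover: some edge \<open>F\<close> passes through
        \<open>x\<close> and meets the part in exactly one vertex, which therefore is
        \<open>x\<close>.\<close>
      have "\<exists>F\<in>H. P i \<inter> F = {x}" if x: "x \<in> P i" for x
      proof -
        have "x \<in> \<Union>H" using x i P X(3) by blast
        then obtain F where F: "F \<in> H" "x \<in> F" by blast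
        obtain y where "P i \<inter> F = {y}"
          using meets_once[rule_format, OF i F(1)] by (rule card_1_singletonE)
        moreover have "x \<in> P i \<inter> F" using F(2) x by (rule IntI[rotated])
        ultimately have "P i \<inter> F = {x}" by simp
        then show ?thesis using F by blast
      qed
      then show ?thesis
        using symbolic_power_subset_weight_ideal[OF X(1,2) cover[rule_format, OF i]] f(1) assms(5) by blast
    qed
    then have "n \<le> weight (P i) m" if "i \<in> {1..r}" for i
      using m that by (auto simp: weight_ideal_def)
    \<comment> \<open>Each of the \<open>r\<close> parts contributes at least \<open>n\<close>;
      being disjoint with union \<open>X\<close>, they split the weight over \<open>X\<close>, which
      is the degree.\<close>
    then have "(\<Sum>i\<in>{1..r}. n) \<le> (\<Sum>i\<in>{1..r}. weight (P i) m)" by (intro sum_mono)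
    also have "\<dots> = weight X m"
      unfolding weight_def P
    proof (rule sum.UNION_disjoint[symmetric])
      show "\<forall>i\<in>{1..r}. finite (P i)" using P X(1) by (auto intro: finite_subset)
    qed (use disjoint in simp_all)
    also have "\<dots> = monomial_degree m"
      using f(1) m X(1) by (intro monomial_degree_eq_weight[symmetric]) (auto simp: symbolic_power_def)
    also have "\<dots> = d" using f(3) m by (simp add: homogeneous_def)
    finally show "r * n \<le> d" by simp
  qed
  \<comment> \<open>At \<open>n = 0\<close> division by zero gives the value 0, hence equality with
    \<open>r\<close> is claimed only eventually.\<close>
  have "eventually (\<lambda>n. waldschmidt_seq X I n = real r) sequentially"
    using eventually_gt_at_top[of 0] by eventually_elim (simp add: waldschmidt_seq_def degree)
  then have "waldschmidt_seq X I \<longlonglongrightarrow> real r" by (rule tendsto_eventually)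
  then show ?thesis
    by (auto simp: waldschmidt_constant_def convergent_def intro: limI)
qed

end
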